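(* Consider the Hooke billiard with a centered conic section $\mathcal{B}_H$ as boundary, and a billiard orbit with flight ellipses $\mathcal{H}_i$, where $\mathcal{H}_i$ has foci $\pm F_i$. Then the foci of the flight ellipses $\mathcal{H}_i$ all lie on one common curve given by a Cassini oval of the form $$[(x-\mathbf{c}_H)^2+y^2]\cdot[(x+\mathbf{c}_H)^2+y^2]=R_H^4,$$ where $\mathbf{c}_H$ is the linear eccentricity of $\mathcal{B}_H$ and $R_H\ge 0$ is a constant along the billiard orbit (a generalised radius).
   Context: Hooke billiard: a particle of mass $m>0$ moves in the plane with Hamiltonian $H_H=\frac{p_x^2+p_y^2}{2m}+\frac{k}{2}(x^2+y^2)$, with $k>0$ (attractive case), so its unreflected orbits are arcs of ellipses centered at the origin (possibly degenerate to segments). The boundary (mirror) is the centered conic $\mathcal{B}_H:\ \frac{x^2}{\mathbf{a}_H^2}+\frac{y^2}{\mathbf{a}_H^2-\mathbf{c}_H^2}=1$ with foci $(\pm\mathbf{c}_H,0)$, an ellipse if $\mathbf{c}_H<\mathbf{a}_H$ and a hyperbola if $\mathbf{c}_H>\mathbf{a}_H$. The particle moves on one side of $\mathcal{B}_H$ (mainly the side not containing the origin), and when it hits $\mathcal{B}_H$ at a point $P$ its velocity is reflected in the tangent line of $\mathcal{B}_H$ at $P$ (elastic reflection). The flight ellipse $\mathcal{H}_i$ is the full Hooke ellipse containing the $i$-th orbit arc between consecutive reflections; its foci are a pair $\pm F_i$ symmetric about the origin. *)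

theory Defs
  imports "HOL-Analysis.Analysis"
begin

type_synonym plane = "real \<times> real"

text \<open>Hamilton's equations \<open>q' = \<partial>H/\<partial>p\<close>, \<open>p' = - \<partial>H/\<partial>q\<close>, for all times: a solution describes the
  complete unreflected motion, not only the part between two reflections.\<close>

definition hamiltonian_motion ::
    "(plane \<Rightarrow> plane \<Rightarrow> real) \<Rightarrow> (real \<Rightarrow> plane) \<Rightarrow> (real \<Rightarrow> plane) \<Rightarrow> bool" where
  "hamiltonian_motion H q p \<longleftrightarrow>
     (\<forall>s. \<exists>dHq dHp. GDERIV (\<lambda>z. H z (p s)) (q s) :> dHq \<and> GDERIV (\<lambda>w. H (q s) w) (p s) :> dHp \<and>
        (q has_vector_derivative dHp) (at s) \<and> (p has_vector_derivative - dHq) (at s))"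

definition hooke_hamiltonian :: "real \<Rightarrow> real \<Rightarrow> plane \<Rightarrow> plane \<Rightarrow> real" where
  "hooke_hamiltonian m k q p = (case q of (x, y) \<Rightarrow> case p of (px, py) \<Rightarrow>
     (px\<^sup>2 + py\<^sup>2) / (2 * m) + k / 2 * (x\<^sup>2 + y\<^sup>2))"

definition centered_conic :: "real \<Rightarrow> real \<Rightarrow> plane set" where
  "centered_conic a c = {(x, y). x\<^sup>2 / a\<^sup>2 + y\<^sup>2 / (a\<^sup>2 - c\<^sup>2) = 1}"

text \<open>Half the gradient of the function defining the conic.\<close>

definition conic_normal :: "real \<Rightarrow> real \<Rightarrow> plane \<Rightarrow> plane" where
  "conic_normal a c P = (case P of (x, y) \<Rightarrow> (x / a\<^sup>2, y / (a\<^sup>2 - c\<^sup>2)))"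

text \<open>Reflection of \<open>v\<close> in the line through the origin orthogonal to \<open>n\<close>.\<close>

definition reflect_orth :: "plane \<Rightarrow> plane \<Rightarrow> plane" where
  "reflect_orth n v = v - (2 * (v \<bullet> n) / (n \<bullet> n)) *\<^sub>R n"

text \<open>Flight \<open>i\<close> takes place during the time interval from \<open>t i\<close> to \<open>t (i + 1)\<close>, following the
  complete Hooke motion \<open>(q i, p i)\<close>. The index set \<open>I\<close> is an order interval of integers, so that
  finite, one-sided infinite and two-sided infinite orbits are all covered. A reflection happens
  between any two consecutive flights; the outer ends of a first and of a last flight need not lie
  on the mirror. The set \<open>S\<close> is the side on which the particle moves; it can be any connected
  component of the complement of the mirror.\<close>

definition hooke_billiard_orbit ::
    "real \<Rightarrow> real \<Rightarrow> real \<Rightarrow> real \<Rightarrow> plane set \<Rightarrow> int set \<Rightarrow> (int \<Rightarrow> real) \<Rightarrow>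
     (int \<Rightarrow> real \<Rightarrow> plane) \<Rightarrow> (int \<Rightarrow> real \<Rightarrow> plane) \<Rightarrow> bool" where
  "hooke_billiard_orbit m k a c S I t q p \<longleftrightarrow>
     S \<in> components (- centered_conic a c) \<and>
     (\<forall>i\<in>I. \<forall>j\<in>I. {i..j} \<subseteq> I) \<and>
     (\<forall>i\<in>I. t i < t (i + 1) \<and>
        hamiltonian_motion (hooke_hamiltonian m k) (q i) (p i) \<and>
        (\<forall>s. t i < s \<and> s < t (i + 1) \<longrightarrow> q i s \<in> S)) \<and>
     (\<forall>i. i \<in> I \<and> i + 1 \<in> I \<longrightarrow>
        (let s = t (i + 1); P = q i s in
           P \<in> centered_conic a c \<and>
           q (i + 1) s = P \<and>
           (1 / m) *\<^sub>R p (i + 1) s = reflect_orth (conic_normal a c P) ((1 / m) *\<^sub>R p i s)))"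

definition flight_ellipse :: "(real \<Rightarrow> plane) \<Rightarrow> plane set" where
  "flight_ellipse q = range q"

text \<open>In the case of equality \<open>l = dist F\<^sub>1 F\<^sub>2\<close> the ellipse degenerates to the segment
  between its foci.\<close>

definition ellipse_with_foci :: "plane set \<Rightarrow> plane \<Rightarrow> plane \<Rightarrow> bool" where
  "ellipse_with_foci E F\<^sub>1 F\<^sub>2 \<longleftrightarrow> (\<exists>l \<ge> dist F\<^sub>1 F\<^sub>2. E = {P. dist P F\<^sub>1 + dist P F\<^sub>2 = l})"

definition cassini_oval :: "real \<Rightarrow> real \<Rightarrow> plane set" where
  "cassini_oval c R = {(x, y). ((x - c)\<^sup>2 + y\<^sup>2) * ((x + c)\<^sup>2 + y\<^sup>2) = R ^ 4}"

text \<open>The rest of this theory shows that every Hooke motion does trace out an ellipse with foci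
  \<open>F\<close>, \<open>- F\<close>, so that assuming such foci is no restriction.\<close>

lemma hooke_GDERIV_q:
  assumes "GDERIV (\<lambda>z. hooke_hamiltonian m k z w) q :> d"
  shows "d = k *\<^sub>R q"
proof -
  have eq: "(\<lambda>z. hooke_hamiltonian m k z w) = (\<lambda>z. w \<bullet> w / (2 * m) + k / 2 * (z \<bullet> z))"
    by (auto simp: hooke_hamiltonian_def fun_eq_iff power2_eq_square split: prod.splits)
  have "((\<lambda>z. hooke_hamiltonian m k z w) has_derivative (\<lambda>h. h \<bullet> (k *\<^sub>R q))) (at q)"
    unfolding eq by (auto intro!: derivative_eq_intros simp: inner_commute algebra_simps)
  from has_derivative_unique[OF this assms[unfolded gderiv_def]]
  have "h \<bullet> d = h \<bullet> (k *\<^sub>R q)" for h by metis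
  then show ?thesis by (metis vector_eq_rdot inner_commute)
qed

lemma hooke_GDERIV_p:
  assumes "GDERIV (\<lambda>w. hooke_hamiltonian m k z w) p :> d"
  shows "d = (1 / m) *\<^sub>R p"
proof -
  have eq: "(\<lambda>w. hooke_hamiltonian m k z w) = (\<lambda>w. (1 / (2 * m)) * (w \<bullet> w) + k / 2 * (z \<bullet> z))"
    by (auto simp: hooke_hamiltonian_def fun_eq_iff power2_eq_square split: prod.splits)
  have "((\<lambda>w. hooke_hamiltonian m k z w) has_derivative (\<lambda>h. h \<bullet> ((1 / m) *\<^sub>R p))) (at p)"
    unfolding eq by (cases "m = 0") (auto intro!: derivative_eq_intros simp: inner_commute algebra_simps)
  from has_derivative_unique[OF this assms[unfolded gderiv_def]]
  have "h \<bullet> d = h \<bullet> ((1 / m) *\<^sub>R p)" for h by metis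
  then show ?thesis by (metis vector_eq_rdot inner_commute)
qed

lemma hooke_motion_solution:
  assumes "m > 0" "k > 0" and mot: "hamiltonian_motion (hooke_hamiltonian m k) q p"
  obtains \<omega> A B where "\<omega> > 0" "\<And>s. q s = cos (\<omega> * s) *\<^sub>R A + sin (\<omega> * s) *\<^sub>R B"
proof -
  define \<omega> where "\<omega> = sqrt (k / m)"
  have w: "\<omega> > 0" "\<omega>\<^sup>2 = k / m" using assms by (auto simp: \<omega>_def)
  have kk: "k = \<omega> * (m * \<omega>)" using w assms by (simp add: field_simps power2_eq_square)
  have dq: "(q has_vector_derivative (1 / m) *\<^sub>R p s) (at s)"
    and dp: "(p has_vector_derivative - (k *\<^sub>R q s)) (at s)" for s
    using mot hooke_GDERIV_q hooke_GDERIV_p unfolding hamiltonian_motion_def by metis+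
  define u where "u s = cos (\<omega> * s) *\<^sub>R q s - (sin (\<omega> * s) / (m * \<omega>)) *\<^sub>R p s" for s
  define v where "v s = sin (\<omega> * s) *\<^sub>R q s + (cos (\<omega> * s) / (m * \<omega>)) *\<^sub>R p s" for s
  have du: "(u has_vector_derivative 0) (at s)" for s
    unfolding u_def using w assms
    by (auto intro!: derivative_eq_intros dq dp simp: kk)
  have dv: "(v has_vector_derivative 0) (at s)" for s
    unfolding v_def using w assms
    by (auto intro!: derivative_eq_intros dq dp simp: kk)
  obtain A where A: "\<And>s. u s = A"
    using has_vector_derivative_zero_constant[of UNIV u] du by auto
  obtain B where B: "\<And>s. v s = B"
    using has_vector_derivative_zero_constant[of UNIV v] dv by auto
  have "q s = cos (\<omega> * s) *\<^sub>R A + sin (\<omega> * s) *\<^sub>R B" for s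
  proof -
    have "cos (\<omega> * s) *\<^sub>R u s + sin (\<omega> * s) *\<^sub>R v s = ((cos (\<omega> * s))\<^sup>2 + (sin (\<omega> * s))\<^sup>2) *\<^sub>R q s"
      unfolding u_def v_def
      by (simp add: algebra_simps power2_eq_square del: sin_cos_squared_add3)
    then show ?thesis using A B by simp
  qed
  with w that show thesis by blast
qed

lemma complex_ellipse_foci:
  fixes \<alpha> \<beta> :: complex
  shows "\<exists>F. 2 * cmod F \<le> 2 * (cmod \<alpha> + cmod \<beta>) \<and>
    range (\<lambda>\<theta>. \<alpha> * cis \<theta> + \<beta> * cis (- \<theta>)) = {z. cmod (z - F) + cmod (z + F) = 2 * (cmod \<alpha> + cmod \<beta>)}"
proof -
  define s where "s = csqrt \<alpha>"
  define t where "t = csqrt \<beta>"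
  have st: "\<alpha> = s\<^sup>2" "\<beta> = t\<^sup>2" by (simp_all add: s_def t_def)
  have par: "cmod ((x - y)\<^sup>2) + cmod ((x + y)\<^sup>2) = 2 * ((cmod x)\<^sup>2 + (cmod y)\<^sup>2)" for x y
    unfolding norm_power cmod_power2 by (simp add: algebra_simps power2_eq_square)
  define F where "F = 2 * s * t"
  have sum: "cmod (z - F) + cmod (z + F) = 2 * (cmod \<alpha> * (cmod w)\<^sup>2 + cmod \<beta> / (cmod w)\<^sup>2)"
    if "w \<noteq> 0" "z = \<alpha> * w\<^sup>2 + \<beta> / w\<^sup>2" for z w
  proof -
    have "z - F = (s * w - t / w)\<^sup>2" "z + F = (s * w + t / w)\<^sup>2"
      using that by (simp_all add: st F_def power2_eq_square field_simps)
    then show ?thesis using par[of "s * w" "t / w"]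
      by (simp add: st norm_mult norm_divide norm_power power_mult_distrib power_divide)
  qed
  have "cmod F \<le> cmod \<alpha> + cmod \<beta>"
    using sum_squares_bound[of "cmod s" "cmod t"]
    by (simp add: F_def st norm_mult norm_power)
  moreover have "\<alpha> * cis \<theta> + \<beta> * cis (- \<theta>) \<in> {z. cmod (z - F) + cmod (z + F) = 2 * (cmod \<alpha> + cmod \<beta>)}" for \<theta>
  proof -
    have "(cis (\<theta> / 2))\<^sup>2 = cis \<theta>" by (simp add: power2_eq_square cis_mult)
    moreover have "\<beta> * cis (- \<theta>) = \<beta> / cis \<theta>" by (simp add: field_simps cis_mult)
    ultimately show ?thesis using sum[of "cis (\<theta> / 2)" "\<alpha> * cis \<theta> + \<beta> * cis (- \<theta>)"] by simp
  qed
  moreover have "z \<in> range (\<lambda>\<theta>. \<alpha> * cis \<theta> + \<beta> * cis (- \<theta>))"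
    if z: "cmod (z - F) + cmod (z + F) = 2 * (cmod \<alpha> + cmod \<beta>)" for z
  proof -
    have unit: ?thesis if "cmod v = 1" "z = \<alpha> * v + \<beta> / v" for v
    proof -
      have "v = cis (Arg v)" using that(1) cis_Arg[of v] by (cases "v = 0") (auto simp: sgn_div_norm)
      then have "z = \<alpha> * cis (Arg v) + \<beta> * cis (- Arg v)"
        using that(2) by (metis cis_inverse divide_inverse)
      then show ?thesis by blast
    qed
    show ?thesis
    proof (cases "\<alpha> = 0 \<or> \<beta> = 0")
      case True
      then have F0: "F = 0" by (auto simp: F_def st)
      have nz: "cmod z = cmod \<alpha> + cmod \<beta>" using z F0 by simp
      consider "\<alpha> = 0" "\<beta> = 0" | "\<alpha> = 0" "\<beta> \<noteq> 0" | "\<alpha> \<noteq> 0" "\<beta> = 0" using True by blast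
      then show ?thesis
      proof cases
        case 1 then show ?thesis using nz unit[of 1] by simp
      next
        case 2
        have "z \<noteq> 0" using 2 nz by auto
        then show ?thesis using 2 nz unit[of "\<beta> / z"] by (simp add: norm_divide)
      next
        case 3 then show ?thesis using nz unit[of "z / \<alpha>"] by (simp add: norm_divide)
      qed
    next
      case False
      then have nz: "\<alpha> \<noteq> 0" "\<beta> \<noteq> 0" by auto
      define d where "d = csqrt (z\<^sup>2 - 4 * \<alpha> * \<beta>)"
      define v where "v = (z + d) / (2 * \<alpha>)"
      have d2: "d\<^sup>2 = z\<^sup>2 - 4 * \<alpha> * \<beta>" by (simp add: d_def)
      have "(2 * \<alpha>) * (\<alpha> * v\<^sup>2 - z * v + \<beta>) * 2 = (z + d)\<^sup>2 - 2 * z * (z + d) + 4 * \<alpha> * \<beta>"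
        using nz by (simp add: v_def power2_eq_square field_simps)
      also have "\<dots> = 0" using d2 by (simp add: power2_eq_square algebra_simps)
      finally have quad: "\<alpha> * v\<^sup>2 - z * v + \<beta> = 0" using nz by simp
      have v0: "v \<noteq> 0" using quad nz by auto
      have zv: "z = \<alpha> * v + \<beta> / v" using quad v0 by (simp add: field_simps power2_eq_square)
      define w where "w = csqrt v"
      have w: "w\<^sup>2 = v" "w \<noteq> 0" using v0 by (auto simp: w_def)
      define r where "r = cmod v"
      have r: "r > 0" "(cmod w)\<^sup>2 = r" using v0 w by (auto simp: r_def norm_power[symmetric])
      have "cmod \<alpha> * r + cmod \<beta> / r = cmod \<alpha> + cmod \<beta>"
        using sum[of w z] w zv z r by simp
      then have "(r - 1) * (cmod \<alpha> * r - cmod \<beta>) = 0"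
        using r by (simp add: field_simps)
      then consider "r = 1" | "cmod \<alpha> * r = cmod \<beta>" by auto
      then show ?thesis
      proof cases
        case 1 then show ?thesis using unit[of v] zv r_def by simp
      next
        case 2
        have "cmod (\<beta> / (\<alpha> * v)) = 1" using 2 nz r by (auto simp: norm_divide norm_mult r_def)
        moreover have "z = \<alpha> * (\<beta> / (\<alpha> * v)) + \<beta> / (\<beta> / (\<alpha> * v))"
          using zv nz v0 by (simp add: field_simps)
        ultimately show ?thesis by (rule unit)
      qed
    qed
  qed
  ultimately show ?thesis by (intro exI[of _ F]) auto
qed

lemma flight_ellipse_has_foci:
  assumes "m > 0" "k > 0" "hamiltonian_motion (hooke_hamiltonian m k) q p"
  shows "\<exists>F. ellipse_with_foci (flight_ellipse q) F (- F)"
proof -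
  define C :: "plane \<Rightarrow> complex" where "C P = Complex (fst P) (snd P)" for P
  obtain \<omega> A B where w: "\<omega> > 0" and q: "\<And>s. q s = cos (\<omega> * s) *\<^sub>R A + sin (\<omega> * s) *\<^sub>R B"
    using hooke_motion_solution[OF assms] by metis
  define \<alpha> where "\<alpha> = (C A - \<i> * C B) / 2"
  define \<beta> where "\<beta> = (C A + \<i> * C B) / 2"
  have Cq: "C (q s) = \<alpha> * cis (\<omega> * s) + \<beta> * cis (- (\<omega> * s))" for s
    by (simp add: q C_def \<alpha>_def \<beta>_def complex_eq_iff field_simps)
  have dC: "dist P Q = cmod (C P - C Q)" for P Q
    by (cases P; cases Q) (simp add: C_def dist_Pair_Pair cmod_def dist_real_def)
  have injC: "C P = C Q \<longleftrightarrow> P = Q" for P Q by (auto simp: C_def prod_eq_iff)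
  obtain F where F: "2 * cmod F \<le> 2 * (cmod \<alpha> + cmod \<beta>)"
    "range (\<lambda>\<theta>. \<alpha> * cis \<theta> + \<beta> * cis (- \<theta>)) = {z. cmod (z - F) + cmod (z + F) = 2 * (cmod \<alpha> + cmod \<beta>)}"
    using complex_ellipse_foci by blast
  define G :: plane where "G = (Re F, Im F)"
  have CG: "C G = F" "C (- G) = - F" by (auto simp: C_def G_def complex_eq_iff)
  have "P \<in> range q \<longleftrightarrow> dist P G + dist P (- G) = 2 * (cmod \<alpha> + cmod \<beta>)" for P
  proof -
    have "P \<in> range q \<longleftrightarrow> (\<exists>s. C P = \<alpha> * cis (\<omega> * s) + \<beta> * cis (- (\<omega> * s)))"
      by (auto simp: Cq[symmetric] injC)
    also have "\<dots> \<longleftrightarrow> (\<exists>\<theta>. C P = \<alpha> * cis \<theta> + \<beta> * cis (- \<theta>))"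
    proof
      assume "\<exists>\<theta>. C P = \<alpha> * cis \<theta> + \<beta> * cis (- \<theta>)"
      then obtain \<theta> where "C P = \<alpha> * cis \<theta> + \<beta> * cis (- \<theta>)" by blast
      moreover have "\<theta> = \<omega> * (\<theta> / \<omega>)" using w by simp
      ultimately show "\<exists>s. C P = \<alpha> * cis (\<omega> * s) + \<beta> * cis (- (\<omega> * s))" by metis
    qed blast
    also have "\<dots> \<longleftrightarrow> cmod (C P - F) + cmod (C P + F) = 2 * (cmod \<alpha> + cmod \<beta>)"
      using F(2) by blast
    finally show ?thesis by (simp add: dC CG)
  qed
  moreover have "dist G (- G) \<le> 2 * (cmod \<alpha> + cmod \<beta>)"
  proof -
    have "dist G (- G) = cmod (F + F)" by (simp add: dC CG)
    also have "\<dots> \<le> 2 * cmod F" using norm_triangle_ineq[of F F] by simp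
    finally show ?thesis using F(1) by simp
  qed
  ultimately show ?thesis
    unfolding ellipse_with_foci_def flight_ellipse_def
    by (intro exI[of _ G] exI[of _ "2 * (cmod \<alpha> + cmod \<beta>)"]) auto
qed

end

theory Submission
  imports Defs
begin

text \<open>Identify the plane with \<open>\<complex>\<close>. A flight \<open>q s = cos (\<omega> s) A + sin (\<omega> s) B\<close> has foci \<open>\<plusminus> F\<close> with
  \<open>F\<^sup>2 = A\<^sup>2 + B\<^sup>2 = q\<^sup>2 + u\<^sup>2\<close>, where \<open>u = q' / \<omega>\<close>, and \<open>F\<close> lies on a Cassini oval whose radius is
  given by \<open>\<bar>F\<^sup>2 - c\<^sup>2\<bar> = \<bar>(q\<^sup>2 - c\<^sup>2) + u\<^sup>2\<bar>\<close>. At a point \<open>q\<close> of the mirror with normal \<open>n\<close> the focal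
  property of the conic says that \<open>q\<^sup>2 - c\<^sup>2\<close> is a real multiple of \<open>n\<^sup>2\<close>. Hence this modulus only
  depends on \<open>\<bar>u\<bar>\<close> and \<open>(u \<bullet> n)\<^sup>2\<close>, both of which are preserved by the reflection.\<close>

section \<open>The plane as the complex numbers\<close>

definition plane_complex :: "plane \<Rightarrow> complex" where
  "plane_complex P = Complex (fst P) (snd P)"

lemma plane_complex_simps:
  "plane_complex (x, y) = Complex x y"
  "plane_complex (P + Q) = plane_complex P + plane_complex Q"
  "plane_complex (P - Q) = plane_complex P - plane_complex Q"
  "plane_complex (- P) = - plane_complex P"
  "plane_complex (r *\<^sub>R P) = of_real r * plane_complex P"
  by (auto simp: plane_complex_def complex_eq_iff)

lemma plane_complex_square: "(plane_complex (x, y))\<^sup>2 = Complex (x\<^sup>2 - y\<^sup>2) (2 * x * y)"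
  by (simp add: plane_complex_def complex_eq_iff power2_eq_square)

text \<open>The two factors are the squared moduli of \<open>z - c\<close> and \<open>z + c\<close>,
  whose product is \<open>z^2 - c^2\<close>.\<close>

lemma cassini_oval_iff:
  "P \<in> cassini_oval c R \<longleftrightarrow> (cmod ((plane_complex P)\<^sup>2 - of_real (c\<^sup>2)))\<^sup>2 = R ^ 4"
proof -
  obtain x y where P: "P = (x, y)" by (cases P)
  have "((x - c)\<^sup>2 + y\<^sup>2) * ((x + c)\<^sup>2 + y\<^sup>2) = (x\<^sup>2 - y\<^sup>2 - c\<^sup>2)\<^sup>2 + (2 * x * y)\<^sup>2"
    by (simp add: power2_eq_square algebra_simps)
  then show ?thesis
    unfolding P cassini_oval_def plane_complex_square
    by (simp add: cmod_power2)
qed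

subsection \<open>Reflection at the mirror\<close>

lemma norm_reflect_orth: "norm (reflect_orth n v) = norm v"
proof (cases "n = 0")
  case False
  then have "reflect_orth n v \<bullet> reflect_orth n v = v \<bullet> v"
    unfolding reflect_orth_def
    by (simp add: inner_diff_left inner_diff_right inner_commute[of n v] field_simps)
  then show ?thesis by (simp add: norm_eq_sqrt_inner)
qed (simp add: reflect_orth_def)

lemma reflect_orth_inner_normal: "reflect_orth n v \<bullet> n = - (v \<bullet> n)"
  by (cases "n = 0") (simp_all add: reflect_orth_def inner_diff_left)

lemma reflect_orth_scaleR: "reflect_orth n (r *\<^sub>R v) = r *\<^sub>R reflect_orth n v"
  by (simp add: reflect_orth_def algebra_simps)

text \<open>The cross term comes from the double-angle formula for the angle between
  \<open>u\<close> and \<open>n\<close>. The vector \<open>u\<close> enters only through its norm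
  and the square of \<open>u \<bullet> n\<close>, so reflection cannot change the value.\<close>

lemma norm_add_squares:
  "(cmod (of_real r * (plane_complex n)\<^sup>2 + (plane_complex u)\<^sup>2))\<^sup>2 =
     r\<^sup>2 * norm n ^ 4 + 2 * r * (2 * (u \<bullet> n)\<^sup>2 - (norm n)\<^sup>2 * (norm u)\<^sup>2) + norm u ^ 4"
proof -
  obtain x y where n: "n = (x, y)" by (cases n)
  obtain v w where u: "u = (v, w)" by (cases u)
  have 4: "norm (P :: plane) ^ 4 = ((norm P)\<^sup>2)\<^sup>2" for P by simp
  show ?thesis
    unfolding cmod_power2 unfolding 4 power2_norm_eq_inner n u plane_complex_square
    by (simp add: power2_eq_square algebra_simps)
qed

lemma norm_add_square_reflect_orth:
  "cmod (of_real r * (plane_complex n)\<^sup>2 + (plane_complex (reflect_orth n u))\<^sup>2) =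
   cmod (of_real r * (plane_complex n)\<^sup>2 + (plane_complex u)\<^sup>2)"
proof (rule power2_eq_imp_eq)
  show "(cmod (of_real r * (plane_complex n)\<^sup>2 + (plane_complex (reflect_orth n u))\<^sup>2))\<^sup>2 =
    (cmod (of_real r * (plane_complex n)\<^sup>2 + (plane_complex u)\<^sup>2))\<^sup>2"
    unfolding norm_add_squares norm_reflect_orth reflect_orth_inner_normal by simp
qed auto

text \<open>The left side is the product of the focal radii \<open>P - c\<close> and
  \<open>P + c\<close>, so the identity says that the normal or the tangent bisects their angle: the
  normal for an ellipse (positive factor), the tangent for a hyperbola (negative factor).\<close>

lemma conic_normal_focal:
  assumes "P \<in> centered_conic a c" "a \<noteq> 0" "a\<^sup>2 \<noteq> c\<^sup>2"
  shows "(plane_complex P)\<^sup>2 - of_real (c\<^sup>2) =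
    of_real (a\<^sup>2 * (a\<^sup>2 - c\<^sup>2)) * (plane_complex (conic_normal a c P))\<^sup>2"
proof -
  obtain x y where P: "P = (x, y)" by (cases P)
  define \<alpha> \<beta> where "\<alpha> = a\<^sup>2" and "\<beta> = a\<^sup>2 - c\<^sup>2"
  have nz: "\<alpha> \<noteq> 0" "\<beta> \<noteq> 0" using assms by (auto simp: \<alpha>_def \<beta>_def)
  have c2: "c\<^sup>2 = \<alpha> - \<beta>" by (simp add: \<alpha>_def \<beta>_def)
  have on: "x\<^sup>2 / \<alpha> + y\<^sup>2 / \<beta> = 1"
    using assms by (simp add: P centered_conic_def \<alpha>_def \<beta>_def)
  have "\<alpha> * \<beta> * ((x / \<alpha>)\<^sup>2 - (y / \<beta>)\<^sup>2) = \<beta> * (x\<^sup>2 / \<alpha>) - \<alpha> * (y\<^sup>2 / \<beta>)"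
    using nz by (simp add: field_simps power2_eq_square)
  \<comment> \<open>Regrouped so that the equation of the conic replaces the bracket by 1.\<close>
  also have "\<dots> = (\<beta> - \<alpha>) * (x\<^sup>2 / \<alpha> + y\<^sup>2 / \<beta>) + \<alpha> * (x\<^sup>2 / \<alpha>) - \<beta> * (y\<^sup>2 / \<beta>)"
    by (simp only: left_diff_distrib distrib_left)
  also have "\<dots> = x\<^sup>2 - y\<^sup>2 - c\<^sup>2"
    using nz by (simp add: on c2)
  finally have "x\<^sup>2 - y\<^sup>2 - c\<^sup>2 = \<alpha> * \<beta> * ((x / \<alpha>)\<^sup>2 - (y / \<beta>)\<^sup>2)" ..
  moreover have "2 * x * y = \<alpha> * \<beta> * (2 * (x / \<alpha>) * (y / \<beta>))"
    using nz by simp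
  ultimately show ?thesis
    unfolding P conic_normal_def prod.case plane_complex_square \<beta>_def[symmetric]
    unfolding \<alpha>_def[symmetric] using nz by (simp add: complex_eq_iff)
qed

subsection \<open>The foci of a flight ellipse\<close>

text \<open>Comparing the squared distances to \<open>F\<close> and \<open>- F\<close> makes one
  distance affine in \<open>P \<bullet> F\<close>; squaring it gives a quadratic form in
  \<open>P\<close> with matrix r^2 I - F F^T.\<close>

lemma foci_sum_quadratic:
  fixes F P :: "'a :: real_inner"
  assumes "dist P F + dist P (- F) = 2 * r"
  shows "r\<^sup>2 * (P \<bullet> P) - (P \<bullet> F)\<^sup>2 = r\<^sup>2 * (r\<^sup>2 - F \<bullet> F)"
proof -
  define d e where "d = dist P F" and "e = dist P (- F)"
  have d: "d\<^sup>2 = P \<bullet> P - 2 * (P \<bullet> F) + F \<bullet> F"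
    by (simp add: d_def dist_norm power2_norm_eq_inner inner_diff_left inner_diff_right inner_commute)
  have e: "e\<^sup>2 = P \<bullet> P + 2 * (P \<bullet> F) + F \<bullet> F"
    by (simp add: e_def dist_norm power2_norm_eq_inner inner_add_left inner_add_right inner_commute)
  have s: "e = 2 * r - d" using assms by (simp add: d_def e_def)
  have "r * d = r\<^sup>2 - P \<bullet> F"
    using d e unfolding s by (simp add: power2_eq_square algebra_simps)
  then have "r\<^sup>2 * d\<^sup>2 = (r\<^sup>2 - P \<bullet> F)\<^sup>2" by (metis power_mult_distrib)
  then show ?thesis unfolding d by (simp add: power2_eq_square algebra_simps)
qed

text \<open>If \<open>N = (A B)\<close> and \<open>M\<close> is the symmetric matrix with entries \<open>p, r, s\<close>, then
  \<open>N\<^sup>T M N = (det M) I\<close> implies that \<open>N N\<^sup>T\<close> is the adjugate of \<open>M\<close>.\<close>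

lemma conjugate_diameters_adjugate:
  fixes x y v w p r s :: real
  assumes AA: "p * x\<^sup>2 + 2 * r * x * y + s * y\<^sup>2 = p * s - r\<^sup>2"
    and BB: "p * v\<^sup>2 + 2 * r * v * w + s * w\<^sup>2 = p * s - r\<^sup>2"
    and AB: "p * x * v + r * (x * w + y * v) + s * y * w = 0"
    and pos: "p * s - r\<^sup>2 \<noteq> 0"
  shows "x\<^sup>2 + v\<^sup>2 = s" "y\<^sup>2 + w\<^sup>2 = p" "x * y + v * w = - r"
proof -
  define D where "D = x * w - y * v"
  \<comment> \<open>Determinants of both sides of N^T M N = (det M) I, with D = det N.\<close>
  have "(p * s - r\<^sup>2) * D\<^sup>2 = (p * x\<^sup>2 + 2 * r * x * y + s * y\<^sup>2) * (p * v\<^sup>2 + 2 * r * v * w + s * w\<^sup>2)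
      - (p * x * v + r * (x * w + y * v) + s * y * w)\<^sup>2"
    unfolding D_def by (simp add: power2_eq_square algebra_simps)
  then have "(p * s - r\<^sup>2) * D\<^sup>2 = (p * s - r\<^sup>2) * (p * s - r\<^sup>2)"
    unfolding AA BB AB by simp
  then have D2: "D\<^sup>2 = p * s - r\<^sup>2" using pos by simp
  then have D: "D \<noteq> 0" using pos by auto
  \<comment> \<open>Entries of M N = D cof(N), multiplied by D to avoid inverses.\<close>
  have "D * (p * x + r * y) = D * (D * w)" "D * (r * x + s * y) = D * (- D * v)"
    "D * (p * v + r * w) = D * (- D * y)" "D * (r * v + s * w) = D * (D * x)"
    using AA BB AB D2 unfolding D_def by algebra+
  then have 1: "p * x + r * y = D * w" and 2: "r * x + s * y = - D * v"
    and 3: "p * v + r * w = - D * y" and 4: "r * v + s * w = D * x"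
    by (simp_all only: mult_left_cancel[OF D])
  have "D * (x\<^sup>2 + v\<^sup>2) = D * s" "D * (y\<^sup>2 + w\<^sup>2) = D * p" "D * (x * y + v * w) = D * (- r)"
    using 1 2 3 4 unfolding D_def by algebra+
  then show "x\<^sup>2 + v\<^sup>2 = s" "y\<^sup>2 + w\<^sup>2 = p" "x * y + v * w = - r"
    by (simp_all only: mult_left_cancel[OF D])
qed

text \<open>In polar form the combination is \<open>r * cos (\<theta> - Arg (Complex x y))\<close>.
  Its maximum \<open>r\<close> is at most 1 by the bound and at least 1 by the attained
  value.\<close>

lemma trig_combination_sum_squares:
  fixes x y :: real
  assumes le: "\<And>\<theta>. \<bar>cos \<theta> * x + sin \<theta> * y\<bar> \<le> 1" and eq: "cos \<phi> * x + sin \<phi> * y = 1"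
  shows "x\<^sup>2 + y\<^sup>2 = 1"
proof -
  define r where "r = cmod (Complex x y)"
  define \<theta> where "\<theta> = Arg (Complex x y)"
  have "Complex x y = rcis r \<theta>" by (simp add: r_def \<theta>_def rcis_cmod_Arg)
  then have xy: "x = r * cos \<theta>" "y = r * sin \<theta>" by (simp_all add: complex_eq_iff)
  have r0: "r \<ge> 0" by (simp add: r_def)
  have "cos \<theta> * x + sin \<theta> * y = r * ((cos \<theta>)\<^sup>2 + (sin \<theta>)\<^sup>2)"
    unfolding xy by (simp add: power2_eq_square algebra_simps del: sin_cos_squared_add3)
  then have "r \<le> 1" using le[of \<theta>] by simp
  moreover have "r * cos (\<phi> - \<theta>) = 1"
    using eq unfolding xy by (simp add: cos_diff algebra_simps)
  then have "1 \<le> r" using r0 cos_le_one[of "\<phi> - \<theta>"] mult_left_mono[of "cos (\<phi> - \<theta>)" 1 r] by simp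
  moreover have "x\<^sup>2 + y\<^sup>2 = r\<^sup>2" by (simp add: r_def cmod_power2)
  ultimately show ?thesis by simp
qed

text \<open>For a proper ellipse, \<open>A\<close> and \<open>B\<close> are conjugate
  semi-diameters, and N N^T = adj(r^2 I - F F^T) yields the real and imaginary parts. This
  determinant vanishes for a segment, which is treated separately.\<close>

lemma ellipse_foci_square:
  fixes A B F :: plane
  assumes "ellipse_with_foci (range (\<lambda>\<theta>. cos \<theta> *\<^sub>R A + sin \<theta> *\<^sub>R B)) F (- F)"
  shows "(plane_complex F)\<^sup>2 = (plane_complex A)\<^sup>2 + (plane_complex B)\<^sup>2"
proof -
  define q where "q \<theta> = cos \<theta> *\<^sub>R A + sin \<theta> *\<^sub>R B" for \<theta>
  obtain l where "l \<ge> dist F (- F)" and E: "range q = {P. dist P F + dist P (- F) = l}"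
    using assms unfolding ellipse_with_foci_def q_def by blast
  define r where "r = l / 2"
  have rF: "r \<ge> norm F" using \<open>l \<ge> dist F (- F)\<close>
    by (simp add: r_def dist_norm flip: scaleR_2)
  have l: "l = 2 * r" by (simp add: r_def)
  have on: "dist (q \<theta>) F + dist (q \<theta>) (- F) = 2 * r" for \<theta>
    using E unfolding l by blast
  \<comment> \<open>The quadratic form at these three angles gives its values at \<open>A\<close>,
    \<open>B\<close> and \<open>A + B\<close>; polarisation then makes \<open>A\<close> and
    \<open>B\<close> conjugate.\<close>
  have q0: "q 0 = A" "q (pi / 2) = B" "q (pi / 4) = (sqrt 2 / 2) *\<^sub>R (A + B)"
    by (simp_all add: q_def cos_45 sin_45 scaleR_add_right)
  show ?thesis
  proof (cases "r = norm F")
    case False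
    then have lt: "r > norm F" using rF by simp
    obtain f g where F: "F = (f, g)" by (cases F)
    obtain x y where A: "A = (x, y)" by (cases A)
    obtain v w where B: "B = (v, w)" by (cases B)
    define \<mu> where "\<mu> = r\<^sup>2 * (r\<^sup>2 - F \<bullet> F)"
    have "(norm F)\<^sup>2 < r\<^sup>2" using lt by (intro power_strict_mono) auto
    moreover from this have "0 < r\<^sup>2" by (meson le_less_trans zero_le_power2)
    ultimately have pos: "\<mu> > 0"
      unfolding \<mu>_def power2_norm_eq_inner by simp
    have det: "(r\<^sup>2 - f\<^sup>2) * (r\<^sup>2 - g\<^sup>2) - (- (f * g))\<^sup>2 = \<mu>"
      by (simp add: \<mu>_def F power2_eq_square algebra_simps)
    note quad = on[THEN foci_sum_quadratic, folded \<mu>_def]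
    have AA: "(r\<^sup>2 - f\<^sup>2) * x\<^sup>2 + 2 * (- (f * g)) * x * y + (r\<^sup>2 - g\<^sup>2) * y\<^sup>2 = \<mu>"
      using quad[of 0] unfolding q0 by (simp add: A F power2_eq_square algebra_simps)
    have BB: "(r\<^sup>2 - f\<^sup>2) * v\<^sup>2 + 2 * (- (f * g)) * v * w + (r\<^sup>2 - g\<^sup>2) * w\<^sup>2 = \<mu>"
      using quad[of "pi / 2"] unfolding q0 by (simp add: B F power2_eq_square algebra_simps)
    have sqrt2: "sqrt 2 * (sqrt 2 * z) = 2 * z" for z by (simp flip: mult.assoc)
    have "r\<^sup>2 * ((A + B) \<bullet> (A + B)) - ((A + B) \<bullet> F)\<^sup>2 = 2 * \<mu>"
      using quad[of "pi / 4"] unfolding q0 inner_scaleR_left inner_scaleR_right power_mult_distrib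
      by (simp add: power_divide sqrt2)
    then have AB: "(r\<^sup>2 - f\<^sup>2) * x * v + (- (f * g)) * (x * w + y * v) + (r\<^sup>2 - g\<^sup>2) * y * w = 0"
      using AA BB by (simp add: A B F power2_eq_square algebra_simps)
    have "\<mu> \<noteq> 0" using pos by simp
    from conjugate_diameters_adjugate[OF AA[folded det] BB[folded det] AB this[folded det]]
    show ?thesis
      unfolding A B F plane_complex_square by (simp add: complex_eq_iff)
  next
    case True
    have seg: "\<exists>z. \<bar>z\<bar> \<le> 1 \<and> q \<theta> = z *\<^sub>R F" for \<theta>
    proof -
      have "dist (- F) F = 2 * norm F"
        by (simp add: dist_norm norm_minus_commute[of "- F"] flip: scaleR_2)
      then have "q \<theta> \<in> closed_segment (- F) F"
        using on[of \<theta>] True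
        by (simp add: between_mem_segment[symmetric] between dist_commute)
      then obtain u where u: "0 \<le> u" "u \<le> 1" "q \<theta> = (1 - u) *\<^sub>R - F + u *\<^sub>R F"
        by (auto simp: in_segment)
      have "q \<theta> = (2 * u - 1) *\<^sub>R F"
        unfolding u(3) by (simp add: algebra_simps flip: scaleR_2)
      then show ?thesis using u by (intro exI[of _ "2 * u - 1"]) auto
    qed
    obtain x y where A: "A = x *\<^sub>R F" and B: "B = y *\<^sub>R F"
      using seg[of 0] seg[of "pi / 2"] unfolding q0 by blast
    have q: "q \<theta> = (cos \<theta> * x + sin \<theta> * y) *\<^sub>R F" for \<theta>
      by (simp add: q_def A B algebra_simps)
    show ?thesis
    proof (cases "F = 0")
      case False
      \<comment> \<open>The motion reaches the end of the segment, so the coefficient of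
        \<open>F\<close> attains its bound 1.\<close>
      have "F \<in> range q"
        unfolding E l True by (simp add: dist_norm flip: scaleR_2)
      then obtain \<phi> where "F = q \<phi>" by blast
      then have "1 *\<^sub>R F = (cos \<phi> * x + sin \<phi> * y) *\<^sub>R F" by (simp add: q)
      then have "cos \<phi> * x + sin \<phi> * y = 1"
        using False unfolding scaleR_cancel_right by simp
      moreover have "\<bar>cos \<theta> * x + sin \<theta> * y\<bar> \<le> 1" for \<theta>
        using seg[of \<theta>] False unfolding q by auto
      ultimately have 1: "x\<^sup>2 + y\<^sup>2 = 1" by (rule trig_combination_sum_squares[rotated])
      have "(plane_complex A)\<^sup>2 + (plane_complex B)\<^sup>2 = of_real (x\<^sup>2 + y\<^sup>2) * (plane_complex F)\<^sup>2"
        by (simp add: A B plane_complex_simps power_mult_distrib algebra_simps)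
      then show ?thesis unfolding 1 by simp
    qed (simp add: A B plane_complex_def zero_complex.code[symmetric])
  qed
qed

subsection \<open>Invariance along the orbit\<close>

text \<open>Fixes the frequency, left unspecified in \<open>hooke_motion_solution\<close>, by
  comparing two expressions for the derivative of \<open>p\<close>. At permanent rest at the origin
  they give no information, but there \<open>A = B = 0\<close> works for any frequency.\<close>

lemma hooke_motion_phase:
  assumes "m > 0" "k > 0" and mot: "hamiltonian_motion (hooke_hamiltonian m k) q p"
  obtains A B where
    "\<And>s. q s = cos (sqrt (k / m) * s) *\<^sub>R A + sin (sqrt (k / m) * s) *\<^sub>R B"
    "\<And>s. (1 / sqrt (m * k)) *\<^sub>R p s = cos (sqrt (k / m) * s) *\<^sub>R B - sin (sqrt (k / m) * s) *\<^sub>R A"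
proof -
  obtain \<omega> A B where w: "\<omega> > 0" and q: "\<And>s. q s = cos (\<omega> * s) *\<^sub>R A + sin (\<omega> * s) *\<^sub>R B"
    using hooke_motion_solution[OF assms] by metis
  have dq: "(q has_vector_derivative (1 / m) *\<^sub>R p s) (at s)"
    and dp: "(p has_vector_derivative - (k *\<^sub>R q s)) (at s)" for s
    using mot hooke_GDERIV_q hooke_GDERIV_p unfolding hamiltonian_motion_def by metis+
  have "((\<lambda>s. cos (\<omega> * s) *\<^sub>R A + sin (\<omega> * s) *\<^sub>R B) has_vector_derivative
      \<omega> *\<^sub>R (cos (\<omega> * s) *\<^sub>R B - sin (\<omega> * s) *\<^sub>R A)) (at s)" for s
    by (auto intro!: derivative_eq_intros simp: algebra_simps)
  then have "(q has_vector_derivative \<omega> *\<^sub>R (cos (\<omega> * s) *\<^sub>R B - sin (\<omega> * s) *\<^sub>R A)) (at s)" for s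
    unfolding q[abs_def] .
  from vector_derivative_unique_at[OF dq this]
  have "m *\<^sub>R (1 / m) *\<^sub>R p s = m *\<^sub>R \<omega> *\<^sub>R (cos (\<omega> * s) *\<^sub>R B - sin (\<omega> * s) *\<^sub>R A)" for s by simp
  then have p: "p s = (m * \<omega>) *\<^sub>R (cos (\<omega> * s) *\<^sub>R B - sin (\<omega> * s) *\<^sub>R A)" for s
    using assms by simp
  show thesis
  proof (cases "\<forall>s. q s = 0")
    case True
    then have "A = 0" "B = 0"
      using q[of 0] q[of "pi / 2 / \<omega>"] w by auto
    then show thesis using that[of 0 0] q p by simp
  next
    case False
    then obtain s where s: "q s \<noteq> 0" by blast
    have "((\<lambda>s. (m * \<omega>) *\<^sub>R (cos (\<omega> * s) *\<^sub>R B - sin (\<omega> * s) *\<^sub>R A)) has_vector_derivative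
        - ((m * \<omega>\<^sup>2) *\<^sub>R q s)) (at s)"
      unfolding q by (auto intro!: derivative_eq_intros simp: algebra_simps power2_eq_square)
    then have "(p has_vector_derivative - ((m * \<omega>\<^sup>2) *\<^sub>R q s)) (at s)"
      unfolding p[abs_def] .
    from vector_derivative_unique_at[OF dp this] have "k = m * \<omega>\<^sup>2"
      using s by simp
    then have "sqrt (k / m) = \<omega>" "sqrt (m * k) = m * \<omega>"
      using assms w by (auto simp: real_sqrt_mult real_sqrt_power power2_eq_square)
    then show thesis using that[of A B] q p assms w by simp
  qed
qed

text \<open>The pair of position and scaled momentum is (A, B) turned by a phase, which preserves
  the complex sum of squares. As \<open>s\<close> is arbitrary, it can be a reflection time.\<close>

lemma hooke_foci_square:
  assumes "m > 0" "k > 0" and mot: "hamiltonian_motion (hooke_hamiltonian m k) q p"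
    and foci: "ellipse_with_foci (flight_ellipse q) F (- F)"
  shows "(plane_complex F)\<^sup>2 =
    (plane_complex (q s))\<^sup>2 + (plane_complex ((1 / sqrt (m * k)) *\<^sub>R p s))\<^sup>2"
proof -
  define \<omega> where "\<omega> = sqrt (k / m)"
  have w: "\<omega> \<noteq> 0" using assms by (simp add: \<omega>_def)
  obtain A B where q: "\<And>s. q s = cos (\<omega> * s) *\<^sub>R A + sin (\<omega> * s) *\<^sub>R B"
    and p: "\<And>s. (1 / sqrt (m * k)) *\<^sub>R p s = cos (\<omega> * s) *\<^sub>R B - sin (\<omega> * s) *\<^sub>R A"
    using hooke_motion_phase[OF assms(1-3)] unfolding \<omega>_def by metis
  have "surj (\<lambda>s. \<omega> * s)"
    using w by (intro surjI[of _ "\<lambda>\<theta>. \<theta> / \<omega>"]) simp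
  moreover have "q = (\<lambda>\<theta>. cos \<theta> *\<^sub>R A + sin \<theta> *\<^sub>R B) \<circ> (\<lambda>s. \<omega> * s)"
    by (simp add: fun_eq_iff q)
  ultimately have "range q = range (\<lambda>\<theta>. cos \<theta> *\<^sub>R A + sin \<theta> *\<^sub>R B)"
    by (simp only: image_comp[symmetric])
  then have "(plane_complex F)\<^sup>2 = (plane_complex A)\<^sup>2 + (plane_complex B)\<^sup>2"
    using foci ellipse_foci_square[of A B F] unfolding flight_ellipse_def by simp
  also have "\<dots> = of_real ((cos (\<omega> * s))\<^sup>2 + (sin (\<omega> * s))\<^sup>2) * ((plane_complex A)\<^sup>2 + (plane_complex B)\<^sup>2)"
    by simp
  also have "\<dots> = (plane_complex (q s))\<^sup>2 + (plane_complex ((1 / sqrt (m * k)) *\<^sub>R p s))\<^sup>2"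
    unfolding q p plane_complex_simps
    unfolding of_real_add of_real_mult power2_eq_square by (simp add: algebra_simps)
  finally show ?thesis .
qed

lemma int_interval_invariant:
  fixes I :: "int set" and f :: "int \<Rightarrow> 'a"
  assumes interval: "\<And>i j. i \<in> I \<Longrightarrow> j \<in> I \<Longrightarrow> {i..j} \<subseteq> I"
    and step: "\<And>i. i \<in> I \<Longrightarrow> i + 1 \<in> I \<Longrightarrow> f (i + 1) = f i"
    and "i \<in> I" "j \<in> I"
  shows "f i = f j"
proof -
  have le: "f j = f i" if "i \<le> j" "i \<in> I" "j \<in> I" for i j
    using that
  proof (induction j rule: int_ge_induct)
    case (step j)
    \<comment> \<open>The interval property keeps the intermediate index in
      \<open>I\<close>.\<close>
    then have "j \<in> I" using interval[of i "j + 1"] by auto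
    then show ?case using step assms(2)[of j] by simp
  qed simp
  show ?thesis using le[of i j] le[of j i] assms by (cases "i \<le> j") auto
qed

theorem theorem4p1:
  fixes m k a c :: real and S :: "plane set" and I :: "int set" and t :: "int \<Rightarrow> real"
    and q p :: "int \<Rightarrow> real \<Rightarrow> plane" and F :: "int \<Rightarrow> plane"
  assumes "m > 0" and "k > 0"
    and "a > 0" and "c \<ge> 0" and "c \<noteq> a"
    and "hooke_billiard_orbit m k a c S I t q p"
    and "\<And>i. i \<in> I \<Longrightarrow> ellipse_with_foci (flight_ellipse (q i)) (F i) (- F i)"
  shows "\<exists>R\<ge>0. \<forall>i\<in>I. F i \<in> cassini_oval c R \<and> - F i \<in> cassini_oval c R"
proof -
  note orbit = assms(6)[unfolded hooke_billiard_orbit_def Let_def]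
  define \<rho> where "\<rho> i = cmod ((plane_complex (F i))\<^sup>2 - of_real (c\<^sup>2))" for i
  define u where "u i s = (1 / sqrt (m * k)) *\<^sub>R p i s" for i s
  have F2: "(plane_complex (F i))\<^sup>2 = (plane_complex (q i s))\<^sup>2 + (plane_complex (u i s))\<^sup>2"
    if "i \<in> I" for i s
    using hooke_foci_square[OF assms(1,2) _ assms(7)] orbit that unfolding u_def by blast
  have "a\<^sup>2 \<noteq> c\<^sup>2" using assms by (simp add: power2_eq_iff)
  have step: "\<rho> (i + 1) = \<rho> i" if i: "i \<in> I" "i + 1 \<in> I" for i
  proof -
    define s P n r where "s = t (i + 1)" and "P = q i s" and "n = conic_normal a c P"
      and "r = a\<^sup>2 * (a\<^sup>2 - c\<^sup>2)"
    have P: "P \<in> centered_conic a c" "q (i + 1) s = P"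
      and refl: "(1 / m) *\<^sub>R p (i + 1) s = reflect_orth n ((1 / m) *\<^sub>R p i s)"
      using orbit i unfolding s_def P_def n_def by blast+
    have "p (i + 1) s = reflect_orth n (p i s)"
      using refl assms(1) unfolding reflect_orth_scaleR by simp
    then have u: "u (i + 1) s = reflect_orth n (u i s)"
      by (simp add: u_def reflect_orth_scaleR)
    have focal: "(plane_complex P)\<^sup>2 - of_real (c\<^sup>2) = of_real r * (plane_complex n)\<^sup>2"
      unfolding n_def r_def using conic_normal_focal[OF P(1)] assms(3) \<open>a\<^sup>2 \<noteq> c\<^sup>2\<close> by simp
    \<comment> \<open>At the reflection time both flights are at \<open>P\<close>, so only
      \<open>u\<close> distinguishes their values of \<rho>.\<close>
    have "\<rho> j = cmod (of_real r * (plane_complex n)\<^sup>2 + (plane_complex (u j s))\<^sup>2)"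
      if "j \<in> I" "q j s = P" for j
      unfolding \<rho>_def F2[OF that(1), of s] that(2) focal[symmetric] by (simp add: algebra_simps)
    then show ?thesis
      using i P(2) P_def u norm_add_square_reflect_orth by metis
  qed
  have inv: "\<rho> i = \<rho> j" if "i \<in> I" "j \<in> I" for i j
    using int_interval_invariant[of I \<rho>, OF _ step that] orbit by blast
  obtain R where R: "R \<ge> 0" "\<And>i. i \<in> I \<Longrightarrow> \<rho> i = R\<^sup>2"
  proof (cases "I = {}")
    case False
    then obtain j where "j \<in> I" by blast
    \<comment> \<open>\<rho> is the product of the focus's distances to the foci of the mirror,
      hence R^2.\<close>
    have "\<rho> i = (sqrt (\<rho> j))\<^sup>2" if "i \<in> I" for i
      using inv[OF that \<open>j \<in> I\<close>] by (simp add: \<rho>_def)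
    then show thesis using that[of "sqrt (\<rho> j)"] by (simp add: \<rho>_def)
  qed (use that[of 0] in auto)
  have "F i \<in> cassini_oval c R \<and> - F i \<in> cassini_oval c R" if "i \<in> I" for i
    using R(2)[OF that] unfolding cassini_oval_iff \<rho>_def plane_complex_simps by simp
  with R(1) show ?thesis by blast
qed

end
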